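(* Let $G$ be a connected graph and $\{G_k:k\geq 1\}$ be a self-similar sequence emanating from $G$. Then $\Phi(G_k)=\Phi(G)$ for all $k\geq 1$, where $\Phi$ is any of the following graph invariants: minimum degree, maximum degree, average degree $d_{\rm ave}$, degree-variance $d_{\rm var}$, principal ratio $\gamma$.
   Context: All graphs are finite, undirected, without loops and multiple edges. $V_G$ is the vertex set of $G$, $|G|=|V_G|$, and $d_G(v)$ is the degree of $v\in V_G$. Two vertices $u,v$ of $G$ are automorphically similar if $\varphi(u)=v$ for some automorphism $\varphi$ of $G$; the equivalence classes $\mathcal O_1,\ldots,\mathcal O_\ell$ are the orbits of $G$. Given an ordering $(\mathcal O_1,\ldots,\mathcal O_\ell)$ of the orbits, the orbit divisor matrix of $G$ is $S_G=[s_{i,j}]_{i,j=1}^{\ell}$, where $s_{i,j}$ is the number of vertices in $\mathcal O_j$ adjacent to a vertex $u\in\mathcal O_i$ (this does not depend on the choice of $u\in\mathcal O_i$). Two connected graphs $G$ and $H$, possibly of different order, are orbitally similar if they have the same number of orbits and $S_G=S_H$ for suitable orderings of the orbits of $G$ and of the orbits of $H$. A self-similar sequence emanating from a connected graph $G$ is a sequence $\{G_k:k\geq 1\}$ of connected graphs such that $|G_1|<|G_2|<|G_3|<\cdots$, the graphs $G_1,G_2,G_3,\ldots$ are pairwise orbitally similar, and $G_1$ is isomorphic to $G$. The average degree is $d_{\rm ave}(G)=\frac{1}{|G|}\sum_{v\in V_G}d_G(v)$ and the degree-variance is $d_{\rm var}(G)=\frac{1}{|G|}\sum_{v\in V_G}[d_G(v)-d_{\rm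 ave}(G)]^2$. The principal eigenvector $x_G:V_G\to\mathbb R$ of a connected graph $G$ is the unique function with $A_Gx_G=\varrho(G)x_G$ and $\sum_{v\in V_G}x_G(v)=1$, where $A_G$ is the adjacency matrix and $\varrho(G)$ its spectral radius; its entries are positive. The principal ratio is $\gamma(G)=\dfrac{\max_{v\in V_G}x_G(v)}{\min_{v\in V_G}x_G(v)}$. *)

theory Defs
  imports
    "Graph_Theory.Digraph_Isomorphism"
    "Jordan_Normal_Form.Spectral_Radius"
begin

text \<open>
  A finite simple graph is represented by \<^locale>\<open>pair_graph\<close>: a finite, loop-free, symmetric
  digraph without parallel arcs. Hence \<^term>\<open>out_degree\<close> is the usual degree, and
  \<^const>\<open>Digraph_Component.connected\<close> (which excludes the null graph) is the usual connectedness.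
\<close>

section \<open>Orbits and orbital similarity\<close>

definition automorphically_similar :: "'a pair_pre_digraph \<Rightarrow> 'a \<Rightarrow> 'a \<Rightarrow> bool" where
  "automorphically_similar G u v \<longleftrightarrow> u \<in> pverts G \<and> v \<in> pverts G \<and>
     (\<exists>f. pre_digraph.digraph_isomorphism (with_proj G) f \<and>
          app_iso f (with_proj G) = with_proj G \<and> iso_verts f u = v)"

definition orbits :: "'a pair_pre_digraph \<Rightarrow> 'a set set" where
  "orbits G = pverts G // {(u, v). automorphically_similar G u v}"

definition orbit_ordering :: "'a pair_pre_digraph \<Rightarrow> 'a set list \<Rightarrow> bool" where
  "orbit_ordering G Os \<longleftrightarrow> distinct Os \<and> set Os = orbits G"

text \<open>The choice of \<open>u\<close> below is immaterial, see \<open>orbit_degree_eqI\<close>.\<close>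

definition orbit_degree :: "'a pair_pre_digraph \<Rightarrow> 'a set \<Rightarrow> 'a set \<Rightarrow> nat" where
  "orbit_degree G P Q = card {w \<in> Q. (SOME u. u \<in> P, w) \<in> parcs G}"

definition orbit_divisor_matrix :: "'a pair_pre_digraph \<Rightarrow> 'a set list \<Rightarrow> nat mat" where
  "orbit_divisor_matrix G Os =
     Matrix.mat (length Os) (length Os) (\<lambda>(i, j). orbit_degree G (Os ! i) (Os ! j))"

definition orbitally_similar :: "'a pair_pre_digraph \<Rightarrow> 'b pair_pre_digraph \<Rightarrow> bool" where
  "orbitally_similar G H \<longleftrightarrow>
     (\<exists>Os Ps. orbit_ordering G Os \<and> orbit_ordering H Ps \<and> length Os = length Ps \<and>
        orbit_divisor_matrix G Os = orbit_divisor_matrix H Ps)"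

text \<open>The sequence is indexed from 1; the value at 0 is irrelevant.\<close>

definition self_similar_sequence ::
    "'a pair_pre_digraph \<Rightarrow> (nat \<Rightarrow> 'b pair_pre_digraph) \<Rightarrow> bool" where
  "self_similar_sequence G Gs \<longleftrightarrow>
     (\<forall>k\<ge>1. pair_graph (Gs k) \<and> Digraph_Component.connected (with_proj (Gs k))) \<and>
     (\<forall>k\<ge>1. card (pverts (Gs k)) < card (pverts (Gs (k + 1)))) \<and>
     (\<forall>j\<ge>1. \<forall>k\<ge>1. orbitally_similar (Gs j) (Gs k)) \<and>
     digraph_iso (with_proj (Gs 1)) (with_proj G)"


section \<open>Graph invariants\<close>

definition min_degree :: "'a pair_pre_digraph \<Rightarrow> nat" where
  "min_degree G = Min (out_degree (with_proj G) ` pverts G)"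

definition max_degree :: "'a pair_pre_digraph \<Rightarrow> nat" where
  "max_degree G = Max (out_degree (with_proj G) ` pverts G)"

definition average_degree :: "'a pair_pre_digraph \<Rightarrow> real" where
  "average_degree G =
     (\<Sum>v\<in>pverts G. real (out_degree (with_proj G) v)) / real (card (pverts G))"

definition degree_variance :: "'a pair_pre_digraph \<Rightarrow> real" where
  "degree_variance G =
     (\<Sum>v\<in>pverts G. (real (out_degree (with_proj G) v) - average_degree G)\<^sup>2)
       / real (card (pverts G))"

definition adjacency :: "'a pair_pre_digraph \<Rightarrow> 'a \<Rightarrow> 'a \<Rightarrow> 'c::zero_neq_one" where
  "adjacency G u v = of_bool ((u, v) \<in> parcs G)"

definition adjacency_matrix :: "'a pair_pre_digraph \<Rightarrow> 'a list \<Rightarrow> 'c::zero_neq_one mat" where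
  "adjacency_matrix G vs =
     Matrix.mat (length vs) (length vs) (\<lambda>(i, j). adjacency G (vs ! i) (vs ! j))"

text \<open>The choice of the enumeration \<open>vs\<close> is immaterial, see
  \<open>spectral_radius_adjacency_matrix\<close>.\<close>

definition graph_spectral_radius :: "'a pair_pre_digraph \<Rightarrow> real" where
  "graph_spectral_radius G =
     spectral_radius (adjacency_matrix G (SOME vs. distinct vs \<and> set vs = pverts G))"

text \<open>
  Functions on the vertex set are represented by extensional functions, so that the values outside
  of the vertex set do not spoil uniqueness.
\<close>

definition principal_eigenvector :: "'a pair_pre_digraph \<Rightarrow> 'a \<Rightarrow> real" where
  "principal_eigenvector G =
     (THE x. x \<in> extensional (pverts G) \<and>
        (\<forall>v\<in>pverts G. (\<Sum>u\<in>pverts G. adjacency G v u * x u) = graph_spectral_radius G * x v) \<and>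
        (\<Sum>v\<in>pverts G. x v) = 1)"

definition principal_ratio :: "'a pair_pre_digraph \<Rightarrow> real" where
  "principal_ratio G =
     Max (principal_eigenvector G ` pverts G) / Min (principal_eigenvector G ` pverts G)"


section \<open>Independence of the choices made above\<close>

lemma automorphically_similar_iff:
  assumes "pair_graph G"
  shows "automorphically_similar G u v \<longleftrightarrow> u \<in> pverts G \<and> v \<in> pverts G \<and>
    (\<exists>\<phi>. bij_betw \<phi> (pverts G) (pverts G) \<and>
       (\<forall>a\<in>pverts G. \<forall>b\<in>pverts G. (\<phi> a, \<phi> b) \<in> parcs G \<longleftrightarrow> (a, b) \<in> parcs G) \<and> \<phi> u = v)"
    (is "?L \<longleftrightarrow> ?R")
proof
  interpret pair_graph G by fact
  assume ?L
  then obtain f where f: "pre_digraph.digraph_isomorphism (with_proj G) f"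
      "app_iso f (with_proj G) = with_proj G" "iso_verts f u = v"
    and uv: "u \<in> pverts G" "v \<in> pverts G"
    unfolding automorphically_similar_def by blast
  let ?\<phi> = "iso_verts f"
  have V: "?\<phi> ` pverts G = pverts G" and A: "iso_arcs f ` parcs G = parcs G"
    and t: "iso_tail f = fst" and h: "iso_head f = snd"
    using f(2) by (simp_all add: app_iso_def with_proj_def)
  have inj: "inj_on ?\<phi> (pverts G)"
    and th: "\<And>a. a \<in> parcs G \<Longrightarrow> iso_arcs f a = (?\<phi> (fst a), ?\<phi> (snd a))"
    using f(1) by (auto simp: pre_digraph.digraph_isomorphism_def t h prod_eq_iff)
  have "(?\<phi> a, ?\<phi> b) \<in> parcs G \<longleftrightarrow> (a, b) \<in> parcs G"
    if ab: "a \<in> pverts G" "b \<in> pverts G" for a b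
  proof
    assume "(a, b) \<in> parcs G"
    then show "(?\<phi> a, ?\<phi> b) \<in> parcs G" using A th by force
  next
    assume "(?\<phi> a, ?\<phi> b) \<in> parcs G"
    then obtain e where e: "e \<in> parcs G" "iso_arcs f e = (?\<phi> a, ?\<phi> b)" using A by force
    then have "?\<phi> (fst e) = ?\<phi> a" "?\<phi> (snd e) = ?\<phi> b" using th by auto
    then have "fst e = a" "snd e = b"
      using inj ab e(1) arc_fst_in_verts arc_snd_in_verts by (auto dest: inj_onD)
    then show "(a, b) \<in> parcs G" using e(1) by (cases e) auto
  qed
  then show ?R using uv f(3) inj V by (auto simp: bij_betw_def)
next
  interpret pair_graph G by fact
  assume ?R
  then obtain \<phi> where uv: "u \<in> pverts G" "v \<in> pverts G" "\<phi> u = v"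
    and bij: "bij_betw \<phi> (pverts G) (pverts G)"
    and adj: "\<And>a b. a \<in> pverts G \<Longrightarrow> b \<in> pverts G \<Longrightarrow>
                (\<phi> a, \<phi> b) \<in> parcs G \<longleftrightarrow> (a, b) \<in> parcs G"
    by blast
  define f where "f = \<lparr>iso_verts = \<phi>, iso_arcs = map_prod \<phi> \<phi>, iso_head = snd, iso_tail = fst\<rparr>"
  have inj: "inj_on \<phi> (pverts G)" and V: "\<phi> ` pverts G = pverts G"
    using bij by (auto simp: bij_betw_def)
  have sub: "parcs G \<subseteq> pverts G \<times> pverts G"
    using in_arcsD1 in_arcsD2 by auto
  have injA: "inj_on (map_prod \<phi> \<phi>) (parcs G)"
    by (rule inj_on_subset[OF map_prod_inj_on[OF inj inj] sub])
  have A: "map_prod \<phi> \<phi> ` parcs G = parcs G"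
  proof
    show "map_prod \<phi> \<phi> ` parcs G \<subseteq> parcs G" using sub adj by fastforce
    show "parcs G \<subseteq> map_prod \<phi> \<phi> ` parcs G"
    proof
      fix e assume e: "e \<in> parcs G"
      then have "fst e \<in> \<phi> ` pverts G" "snd e \<in> \<phi> ` pverts G"
        using V arc_fst_in_verts arc_snd_in_verts by simp_all
      then obtain a b where ab: "a \<in> pverts G" "b \<in> pverts G" "fst e = \<phi> a" "snd e = \<phi> b"
        by (elim imageE)
      then have e_eq: "e = map_prod \<phi> \<phi> (a, b)" by (simp add: prod_eq_iff)
      then have "(a, b) \<in> parcs G" using e adj[OF ab(1,2)] by simp
      then show "e \<in> map_prod \<phi> \<phi> ` parcs G" using e_eq by (rule rev_image_eqI)
    qed
  qed
  have "pre_digraph.digraph_isomorphism (with_proj G) f"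
    using inj injA wf_digraph
    by (auto simp: pre_digraph.digraph_isomorphism_def f_def)
  moreover have "app_iso f (with_proj G) = with_proj G"
    by (simp add: app_iso_def with_proj_def f_def V A)
  moreover have "iso_verts f u = v" using uv by (simp add: f_def)
  ultimately show ?L using uv unfolding automorphically_similar_def by blast
qed

lemma equiv_automorphically_similar:
  assumes "pair_graph G"
  shows "equiv (pverts G) {(u, v). automorphically_similar G u v}"
proof (rule equivI)
  let ?aut = "\<lambda>\<phi>. bij_betw \<phi> (pverts G) (pverts G) \<and>
       (\<forall>a\<in>pverts G. \<forall>b\<in>pverts G. (\<phi> a, \<phi> b) \<in> parcs G \<longleftrightarrow> (a, b) \<in> parcs G)"
  note sim = automorphically_similar_iff[OF assms]
  show "{(u, v). automorphically_similar G u v} \<subseteq> pverts G \<times> pverts G"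
    by (auto simp: sim)
  show "refl_on (pverts G) {(u, v). automorphically_similar G u v}"
    by (auto simp: refl_on_def sim intro!: exI[of _ "\<lambda>x. x"] bij_betw_id[unfolded id_def])
  show "sym {(u, v). automorphically_similar G u v}"
  proof (rule symI, clarify)
    fix u v assume "automorphically_similar G u v"
    then obtain \<phi> where \<phi>: "?aut \<phi>" "\<phi> u = v" "u \<in> pverts G" "v \<in> pverts G"
      unfolding sim by blast
    let ?\<psi> = "the_inv_into (pverts G) \<phi>"
    have b: "bij_betw ?\<psi> (pverts G) (pverts G)" using \<phi>(1) bij_betw_the_inv_into by blast
    have inj: "inj_on \<phi> (pverts G)" and im: "\<phi> ` pverts G = pverts G"
      using \<phi>(1) by (auto simp: bij_betw_def)
    have r: "\<phi> (?\<psi> a) = a" "?\<psi> a \<in> pverts G" if "a \<in> pverts G" for a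
      using that f_the_inv_into_f[OF inj] b im by (auto simp: bij_betw_def)
    have "?aut ?\<psi>" using b r \<phi>(1) by metis
    moreover have "?\<psi> v = u" using \<phi> inj by (metis the_inv_into_f_f)
    ultimately show "automorphically_similar G v u" using \<phi> unfolding sim by blast
  qed
  show "trans {(u, v). automorphically_similar G u v}"
  proof (rule transI, clarify)
    fix u v w assume "automorphically_similar G u v" "automorphically_similar G v w"
    then obtain \<phi> \<psi> where *: "?aut \<phi>" "\<phi> u = v" "?aut \<psi>" "\<psi> v = w"
      "u \<in> pverts G" "w \<in> pverts G" unfolding sim by blast
    have "\<phi> a \<in> pverts G" if "a \<in> pverts G" for a
      using *(1) that by (auto simp: bij_betw_def)
    then have "?aut (\<psi> \<circ> \<phi>)" using * by (auto intro: bij_betw_trans)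
    moreover have "(\<psi> \<circ> \<phi>) u = w" using * by simp
    ultimately show "automorphically_similar G u w" using *(5,6) unfolding sim by blast
  qed
qed

lemma orbit_degree_eqI:
  assumes G: "pair_graph G" and P: "P \<in> orbits G" and Q: "Q \<in> orbits G" and u: "u \<in> P"
  shows "orbit_degree G P Q = card {w \<in> Q. (u, w) \<in> parcs G}"
proof -
  note eqv = equiv_automorphically_similar[OF G]
  define t where "t = (SOME u. u \<in> P)"
  have t: "t \<in> P" unfolding t_def using u by (rule someI)
  have "automorphically_similar G t u"
    using quotient_eq_iff[OF eqv P[unfolded orbits_def] P[unfolded orbits_def] t u] by simp
  then obtain \<phi> where bij: "bij_betw \<phi> (pverts G) (pverts G)" and tu: "\<phi> t = u" "t \<in> pverts G"
    and adj: "\<forall>a\<in>pverts G. \<forall>b\<in>pverts G. (\<phi> a, \<phi> b) \<in> parcs G \<longleftrightarrow> (a, b) \<in> parcs G"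
    unfolding automorphically_similar_iff[OF G] by blast
  have QV: "Q \<subseteq> pverts G"
    using Q in_quotient_imp_subset[OF eqv] unfolding orbits_def by blast
  have \<phi>V: "\<phi> w \<in> pverts G" if "w \<in> pverts G" for w
    using bij that by (auto simp: bij_betw_def)
  have Q\<phi>: "\<phi> w \<in> Q \<longleftrightarrow> w \<in> Q" if "w \<in> pverts G" for w
  proof -
    have "automorphically_similar G w (\<phi> w)"
      unfolding automorphically_similar_iff[OF G] using that \<phi>V bij adj by blast
    then have "(w, \<phi> w) \<in> {(u, v). automorphically_similar G u v}"
      "(\<phi> w, w) \<in> {(u, v). automorphically_similar G u v}"
      using eqv by (auto elim!: equivE dest: symD)
    then show ?thesis
      using in_quotient_imp_closed[OF eqv Q[unfolded orbits_def]] by blast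
  qed
  have "bij_betw \<phi> {w \<in> Q. (t, w) \<in> parcs G} {w \<in> Q. (u, w) \<in> parcs G}"
    unfolding bij_betw_def
  proof
    show "inj_on \<phi> {w \<in> Q. (t, w) \<in> parcs G}"
      using bij QV by (auto simp: bij_betw_def intro: inj_on_subset)
    show "\<phi> ` {w \<in> Q. (t, w) \<in> parcs G} = {w \<in> Q. (u, w) \<in> parcs G}" (is "?A = ?B")
    proof
      show "?A \<subseteq> ?B" using Q\<phi> QV adj tu by auto
      show "?B \<subseteq> ?A"
      proof
        fix w assume w: "w \<in> ?B"
        then have "w \<in> \<phi> ` pverts G" using QV bij by (auto simp: bij_betw_def)
        then obtain x where x: "x \<in> pverts G" "w = \<phi> x" by blast
        then have "x \<in> Q" "(t, x) \<in> parcs G" using w Q\<phi> adj tu by auto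
        then show "w \<in> ?A" using x by blast
      qed
    qed
  qed
  then show ?thesis
    unfolding orbit_degree_def t_def[symmetric] by (rule bij_betw_same_card)
qed

lemma eigenvalue_adjacency_matrix:
  fixes k :: "'c::comm_ring_1"
  assumes "distinct vs" "set vs = pverts G"
  shows "eigenvalue (adjacency_matrix G vs) k \<longleftrightarrow>
    (\<exists>x. (\<exists>v\<in>pverts G. x v \<noteq> 0) \<and>
         (\<forall>v\<in>pverts G. (\<Sum>u\<in>pverts G. adjacency G v u * x u) = k * x v))"
    (is "?L \<longleftrightarrow> ?R")
proof -
  let ?n = "length vs"
  have bij: "bij_betw ((!) vs) {..<?n} (pverts G)"
    using assms bij_betw_nth by blast
  have re: "(\<Sum>u\<in>pverts G. h u) = (\<Sum>j<?n. h (vs ! j))" for h :: "'a \<Rightarrow> 'c"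
    using sum.reindex_bij_betw[OF bij, of h] by simp
  have row: "(adjacency_matrix G vs *\<^sub>v w) $ i = (\<Sum>j<?n. adjacency G (vs ! i) (vs ! j) * w $ j)"
    if "i < ?n" "w \<in> carrier_vec ?n" for i and w :: "'c Matrix.vec"
    using that by (simp add: adjacency_matrix_def scalar_prod_def lessThan_atLeast0)
  have all: "(\<forall>v\<in>pverts G. P v) \<longleftrightarrow> (\<forall>i<?n. P (vs ! i))" for P
    using assms(2) by (metis in_set_conv_nth)
  have dim: "dim_row (adjacency_matrix G vs :: 'c mat) = ?n" "dim_col (adjacency_matrix G vs :: 'c mat) = ?n"
    by (simp_all add: adjacency_matrix_def)
  show ?thesis
  proof
    assume ?L
    then obtain w where w: "w \<in> carrier_vec ?n" "w \<noteq> 0\<^sub>v ?n"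
      "adjacency_matrix G vs *\<^sub>v w = k \<cdot>\<^sub>v w"
      unfolding eigenvalue_def eigenvector_def dim by blast
    define x where "x v = w $ (the_inv_into {..<?n} ((!) vs) v)" for v
    have x: "x (vs ! i) = w $ i" if "i < ?n" for i
      unfolding x_def using bij that by (simp add: bij_betw_def the_inv_into_f_f)
    obtain i where i: "i < ?n" "w $ i \<noteq> 0" using w(1,2) by (metis carrier_vecD dim_vec index_zero_vec(1) eq_vecI index_zero_vec(2))
    have "\<exists>v\<in>pverts G. x v \<noteq> 0" using i x assms(2) nth_mem by metis
    moreover have "\<forall>v\<in>pverts G. (\<Sum>u\<in>pverts G. adjacency G v u * x u) = k * x v"
      unfolding all re
    proof (intro allI impI)
      fix i assume i: "i < ?n"
      have "(\<Sum>j<?n. adjacency G (vs ! i) (vs ! j) * x (vs ! j)) =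
            (\<Sum>j<?n. adjacency G (vs ! i) (vs ! j) * w $ j)" using x by simp
      also have "\<dots> = (k \<cdot>\<^sub>v w) $ i" using row[OF i w(1)] w(3) by simp
      also have "\<dots> = k * x (vs ! i)" using i w(1) x by simp
      finally show "(\<Sum>j<?n. adjacency G (vs ! i) (vs ! j) * x (vs ! j)) = k * x (vs ! i)" .
    qed
    ultimately show ?R by blast
  next
    assume ?R
    then obtain x where x: "\<exists>v\<in>pverts G. x v \<noteq> 0"
      "\<forall>v\<in>pverts G. (\<Sum>u\<in>pverts G. adjacency G v u * x u) = k * x v" by blast
    define w where "w = Matrix.vec ?n (\<lambda>i. x (vs ! i))"
    have wc: "w \<in> carrier_vec ?n" by (simp add: w_def)
    obtain i where "i < ?n" "x (vs ! i) \<noteq> 0" using x(1) assms(2) by (metis in_set_conv_nth)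
    then have "w $ i \<noteq> 0\<^sub>v ?n $ i" by (simp add: w_def)
    then have "w \<noteq> 0\<^sub>v ?n" by auto
    moreover have "adjacency_matrix G vs *\<^sub>v w = k \<cdot>\<^sub>v w"
    proof (rule eq_vecI)
      fix i assume "i < dim_vec (k \<cdot>\<^sub>v w)"
      then have i: "i < ?n" by (simp add: w_def)
      show "(adjacency_matrix G vs *\<^sub>v w) $ i = (k \<cdot>\<^sub>v w) $ i"
        using x(2)[unfolded all re] i row[OF i wc] by (simp add: w_def)
    qed (simp add: w_def dim)
    ultimately show ?L
      unfolding eigenvalue_def eigenvector_def dim using wc by blast
  qed
qed

lemma spectral_radius_adjacency_matrix:
  assumes "distinct vs" "set vs = pverts G"
  shows "graph_spectral_radius G = spectral_radius (adjacency_matrix G vs)"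
proof -
  let ?us = "SOME vs. distinct vs \<and> set vs = pverts G"
  have "distinct ?us \<and> set ?us = pverts G" using assms by (intro someI) auto
  then have "eigenvalue (adjacency_matrix G ?us :: complex mat) =
      eigenvalue (adjacency_matrix G vs :: complex mat)"
    by (intro ext) (simp add: eigenvalue_adjacency_matrix assms)
  then show ?thesis
    unfolding graph_spectral_radius_def spectral_radius_def spectrum_def by simp
qed

end

theory Submission
  imports Defs "HOL-Analysis.Function_Topology"
begin

text \<open>
  Colour the vertices of a connected graph so that the number \<open>s i j\<close> of neighbours of colour \<open>j\<close>
  of a vertex of colour \<open>i\<close> depends only on \<open>i\<close> and \<open>j\<close>. All five invariants are then determined
  by the matrix \<open>s\<close>. Degrees are its row sums. Counting the arcs between two colour classes of
  sizes \<open>n i\<close>, \<open>n j\<close> gives \<open>n i * s i j = n j * s j i\<close>, so by connectedness \<open>s\<close> determines the class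
  sizes up to a common factor, which cancels in averages. Averaging a positive eigenfunction over
  the classes gives a positive eigenvector of \<open>s\<close>; lifted to any connected graph with the same
  matrix, it is a positive eigenfunction, hence a multiple of the principal eigenvector
  (Perron-Frobenius). Orbitally similar graphs share such a matrix through their orbits, and
  isomorphic graphs share the adjacency matrix itself.
\<close>

section \<open>A nonnegative eigenfunction by maximising a quadratic form\<close>

text \<open>Maximise the quadratic form of \<open>a\<close> over the nonnegative part of the unit sphere. Since \<open>a\<close> is
  nonnegative, passing to absolute values shows that the maximum \<open>l\<close> bounds the form on the whole
  sphere, so \<open>l\<close> times the identity minus \<open>a\<close> is positive semidefinite and annihilates the maximiser.\<close>

lemma symmetric_nonneg_kernel_eigenfunction:
  fixes a :: "'v \<Rightarrow> 'v \<Rightarrow> real"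
  assumes fin: "finite V" and ne: "V \<noteq> {}"
    and sym: "\<And>u v. u \<in> V \<Longrightarrow> v \<in> V \<Longrightarrow> a u v = a v u"
    and nonneg: "\<And>u v. u \<in> V \<Longrightarrow> v \<in> V \<Longrightarrow> 0 \<le> a u v"
  obtains x :: "'v \<Rightarrow> real" and l :: real
  where "\<forall>v\<in>V. 0 \<le> x v" "\<exists>v\<in>V. x v \<noteq> 0"
    "\<forall>v\<in>V. (\<Sum>u\<in>V. a v u * x u) = l * x v"
proof -
  define q where "q x = (\<Sum>v\<in>V. \<Sum>u\<in>V. a v u * x u * x v)" for x :: "'v \<Rightarrow> real"
  define n where "n x = (\<Sum>v\<in>V. (x v)\<^sup>2)" for x :: "'v \<Rightarrow> real"
  \<comment> \<open>Functions are total on \<open>'v\<close>, so coordinates outside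
    \<open>V\<close> are pinned to 0. This makes \<open>B\<close> a product of compact sets over all
    coordinates, compact by Tychonoff's theorem.\<close>
  define B where "B = PiE UNIV (\<lambda>v. if v \<in> V then {0..1} else {0 :: real})"
  define K where "K = B \<inter> {x. n x = 1}"
  have "compactin (product_topology (\<lambda>_. euclidean) UNIV) B"
    unfolding B_def compactin_PiE by auto
  then have "compact B" by (simp add: euclidean_product_topology)
  moreover have cont: "continuous_on UNIV n" "continuous_on UNIV q"
    unfolding n_def q_def by (auto intro!: continuous_intros continuous_on_product_coordinates)
  have "closed {x. n x = 1}"
    using continuous_closed_preimage_constant[OF cont(1) closed_UNIV] by simp
  ultimately have "compact K" unfolding K_def by (rule compact_Int_closed)
  obtain w where w: "w \<in> V" using ne by blast
  have "n (\<lambda>v. of_bool (v = w)) = (\<Sum>v\<in>V. if v = w then 1 else 0)"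
    unfolding n_def by (rule sum.cong) auto
  then have "(\<lambda>v. of_bool (v = w)) \<in> K"
    using w fin by (auto simp: K_def B_def)
  then have "K \<noteq> {}" by blast
  obtain x where x: "x \<in> K" "\<And>y. y \<in> K \<Longrightarrow> q y \<le> q x"
    using continuous_attains_sup[OF \<open>compact K\<close> \<open>K \<noteq> {}\<close>] cont(2) continuous_on_subset
    by (metis subset_UNIV)
  define l where "l = q x"
  have n0: "0 \<le> n y" for y unfolding n_def by (simp add: sum_nonneg)
  have bound: "q y \<le> l * n y" for y
  proof (cases "n y = 0")
    case True
    then have "\<forall>v\<in>V. y v = 0" using fin by (auto simp: n_def sum_nonneg_eq_0_iff)
    then show ?thesis using True by (simp add: q_def)
  next
    case False
    then have pos: "0 < n y" using n0[of y] by simp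
    define t where "t = sqrt (n y)"
    have t: "t > 0" "t\<^sup>2 = n y" using pos by (auto simp: t_def)
    define z where "z v = (if v \<in> V then \<bar>y v\<bar> / t else 0)" for v
    have "n z = (\<Sum>v\<in>V. (y v)\<^sup>2 / n y)"
      unfolding n_def[of z] using t by (intro sum.cong) (auto simp: z_def power_divide)
    then have nz: "n z = 1" using pos unfolding sum_divide_distrib[symmetric] by (simp add: n_def)
    have "z v \<le> 1" if "v \<in> V" for v
    proof -
      have "(z v)\<^sup>2 \<le> n z" unfolding n_def using fin that by (intro member_le_sum) auto
      then show ?thesis using nz by (simp add: abs_square_le_1)
    qed
    then have "z \<in> K" using nz t by (auto simp: K_def B_def z_def)
    then have "q z \<le> l" using x(2) by (simp add: l_def)
    have "q y \<le> (\<Sum>v\<in>V. \<Sum>u\<in>V. a v u * \<bar>y u\<bar> * \<bar>y v\<bar>)"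
      unfolding q_def
    proof (intro sum_mono)
      fix v u assume vu: "v \<in> V" "u \<in> V"
      have "y u * y v \<le> \<bar>y u\<bar> * \<bar>y v\<bar>" by (metis abs_ge_self abs_mult)
      then show "a v u * y u * y v \<le> a v u * \<bar>y u\<bar> * \<bar>y v\<bar>"
        using mult_left_mono[OF _ nonneg[OF vu]] by (simp add: mult.assoc)
    qed
    also have "\<dots> = n y * q z"
      unfolding q_def sum_distrib_left
      using t by (intro sum.cong) (auto simp: z_def power2_eq_square simp flip: t(2))
    also have "\<dots> \<le> l * n y" using \<open>q z \<le> l\<close> pos by simp
    finally show ?thesis .
  qed
  \<comment> \<open>The residual of the eigenvalue equation serves as direction of perturbation:
    \<open>l * n - q\<close> vanishes at \<open>x\<close> and is nonnegative along
    \<open>x + t e\<close>, while its linear coefficient there is \<open>2 * n e\<close>.\<close>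
  define e where "e v = l * x v - (\<Sum>u\<in>V. a v u * x u)" for v
  have nx: "n x = 1" using x(1) by (simp add: K_def)
  have expand: "l * n (\<lambda>v. x v + t * e v) - q (\<lambda>v. x v + t * e v)
      = 2 * t * n e + t\<^sup>2 * (l * n e - q e)" for t
  proof -
    have ne: "n (\<lambda>v. x v + t * e v) = 1 + 2 * t * (\<Sum>v\<in>V. x v * e v) + t\<^sup>2 * n e"
      unfolding nx[symmetric] n_def sum_distrib_left sum.distrib[symmetric]
      by (rule sum.cong) (auto simp: power2_eq_square algebra_simps)
    \<comment> \<open>Symmetry of \<open>a\<close> merges the two cross terms of the
      expansion.\<close>
    have sw: "(\<Sum>v\<in>V. \<Sum>u\<in>V. a v u * e u * x v) = (\<Sum>v\<in>V. \<Sum>u\<in>V. a v u * x u * e v)"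
      by (subst sum.swap) (auto intro!: sum.cong simp: sym)
    have qe: "q (\<lambda>v. x v + t * e v) =
        l + 2 * t * (\<Sum>v\<in>V. \<Sum>u\<in>V. a v u * x u * e v) + t\<^sup>2 * q e"
    proof -
      have "q (\<lambda>v. x v + t * e v) =
        q x + t * (\<Sum>v\<in>V. \<Sum>u\<in>V. a v u * e u * x v)
        + t * (\<Sum>v\<in>V. \<Sum>u\<in>V. a v u * x u * e v) + t\<^sup>2 * q e"
        unfolding q_def sum_distrib_left sum.distrib[symmetric]
        by (intro sum.cong refl) (auto simp: power2_eq_square algebra_simps)
      then show ?thesis unfolding sw l_def by simp
    qed
    have "l * (\<Sum>v\<in>V. x v * e v) - (\<Sum>v\<in>V. \<Sum>u\<in>V. a v u * x u * e v) = n e"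
      unfolding n_def sum_distrib_left sum_subtractf[symmetric]
    proof (rule sum.cong)
      fix v
      have "(e v)\<^sup>2 = (l * x v - (\<Sum>u\<in>V. a v u * x u)) * e v"
        by (simp add: power2_eq_square e_def)
      then show "l * (x v * e v) - (\<Sum>u\<in>V. a v u * x u * e v) = (e v)\<^sup>2"
        by (simp add: left_diff_distrib sum_distrib_right mult.assoc)
    qed simp
    then have "l * (\<Sum>v\<in>V. x v * e v) = n e + (\<Sum>v\<in>V. \<Sum>u\<in>V. a v u * x u * e v)" by simp
    then have "l * (2 * t * (\<Sum>v\<in>V. x v * e v)) =
        2 * t * (n e + (\<Sum>v\<in>V. \<Sum>u\<in>V. a v u * x u * e v))"
      by (metis mult.left_commute)
    then show ?thesis unfolding ne qe distrib_left by (simp add: right_diff_distrib)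
  qed
  have "n e = 0"
  proof (rule ccontr)
    assume "n e \<noteq> 0"
    then have pos: "0 < n e" using n0[of e] by simp
    define C where "C = l * n e - q e"
    have C: "0 \<le> C" using bound[of e] by (simp add: C_def)
    \<comment> \<open>A negative step so short that the linear term dominates the quadratic one:
      \<open>- t * C \<le> n e\<close>. The summand 1 keeps the denominator positive when
      \<open>C = 0\<close>.\<close>
    define t where "t = - (n e / (C + 1))"
    have t: "t < 0" using pos C by (simp add: t_def)
    have "0 \<le> 2 * t * n e + t\<^sup>2 * C"
      using bound[of "\<lambda>v. x v + t * e v"] expand[of t] by (simp add: C_def)
    also have "\<dots> = t * (2 * n e + t * C)" by (simp add: power2_eq_square algebra_simps)
    finally have "2 * n e + t * C \<le> 0" using t by (simp add: zero_le_mult_iff)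
    moreover have "- t * C \<le> n e"
      using pos C by (simp add: t_def field_simps)
    ultimately show False using pos by simp
  qed
  then have ev: "e v = 0" if "v \<in> V" for v
    using fin that by (auto simp: n_def sum_nonneg_eq_0_iff)
  show thesis
  proof (rule that)
    show "\<forall>v\<in>V. 0 \<le> x v"
      using x(1) by (auto simp: K_def B_def PiE_iff split: if_splits)
    show "\<exists>v\<in>V. x v \<noteq> 0" using nx by (force simp: n_def intro: ccontr)
    show "\<forall>v\<in>V. (\<Sum>u\<in>V. a v u * x u) = l * x v"
      using ev by (simp add: e_def)
  qed
qed

section \<open>Perron-Frobenius theory of connected graphs\<close>

locale connected_pair_graph = pair_graph G for G :: "'a pair_pre_digraph" +
  assumes connected_graph: "Digraph_Component.connected (with_proj G)"
begin

lemma arc_sym: "(u, v) \<in> parcs G \<longleftrightarrow> (v, u) \<in> parcs G"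
  using graph_symmetric by auto

lemma adjacency_sym: "adjacency G u v = adjacency G v u"
  unfolding adjacency_def using arc_sym by simp

lemma pverts_nonempty: "pverts G \<noteq> {}"
  using connected_graph
  by (auto simp: Digraph_Component.connected_def strongly_connected_def mk_symmetric_def)

text \<open>Symmetry of the arcs turns connectedness into directed reachability, so a property
  passed along arcs spreads from one vertex to all. Vanishing and proportionality are propagated
  this way.\<close>

lemma neighbour_induct:
  assumes "u \<in> pverts G" "v \<in> pverts G" "P u"
    and step: "\<And>a b. (a, b) \<in> parcs G \<Longrightarrow> P a \<Longrightarrow> P b"
  shows "P v"
proof -
  have "strongly_connected (with_proj G)"
    using symmetric_connected_imp_strongly_connected[OF _ connected_graph] sym_arcs by simp
  then have "u \<rightarrow>\<^sup>*\<^bsub>with_proj G\<^esub> v" using assms by (auto simp: strongly_connected_def)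
  then show ?thesis
  proof (induction rule: reachable_induct)
    case base
    show ?case by (fact assms(3))
  next
    case (step a b)
    show ?case by (rule assms(4)[OF _ step.IH]) (use step.hyps in simp)
  qed
qed

lemma sum_adjacency: "(\<Sum>u\<in>pverts G. adjacency G v u * f u) = (\<Sum>u | (v, u) \<in> parcs G. f u)"
  for f :: "'a \<Rightarrow> 'c::comm_ring_1"
proof -
  have "{u \<in> pverts G. (v, u) \<in> parcs G} = {u. (v, u) \<in> parcs G}" using in_arcsD2 by auto
  moreover have "(\<Sum>u\<in>pverts G. adjacency G v u * f u) =
      (\<Sum>u\<in>pverts G. if (v, u) \<in> parcs G then f u else 0)"
    by (rule sum.cong) (auto simp: adjacency_def)
  ultimately show ?thesis by (simp add: sum.inter_filter[symmetric] pair_finite_verts)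
qed

lemma out_degree_eq_card: "out_degree (with_proj G) v = card {u. (v, u) \<in> parcs G}"
proof -
  have "out_arcs (with_proj G) v = Pair v ` {u. (v, u) \<in> parcs G}"
    by (auto simp: out_arcs_def)
  then show ?thesis by (simp add: out_degree_def card_image inj_on_def)
qed

lemma finite_neighbours: "finite {u. (v, u) \<in> parcs G}"
  by (rule finite_subset[OF _ pair_finite_verts]) (auto dest: in_arcsD2)

abbreviation eigenfunction :: "'c::comm_ring_1 \<Rightarrow> ('a \<Rightarrow> 'c) \<Rightarrow> bool" where
  "eigenfunction k x \<equiv> \<forall>v\<in>pverts G. (\<Sum>u\<in>pverts G. adjacency G v u * x u) = k * x v"

text \<open>At a zero of \<open>x\<close> the eigenvalue equation is a vanishing sum of nonnegative
  terms, so \<open>x\<close> vanishes at all neighbours and, by connectedness, everywhere.\<close>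

lemma nonneg_eigenfunction_pos:
  fixes x :: "'a \<Rightarrow> real"
  assumes "eigenfunction l x" and nonneg: "\<And>v. v \<in> pverts G \<Longrightarrow> 0 \<le> x v"
    and "\<exists>v\<in>pverts G. x v \<noteq> 0" and v: "v \<in> pverts G"
  shows "0 < x v"
proof (rule ccontr)
  assume "\<not> 0 < x v"
  then have "x v = 0" using nonneg[OF v] by simp
  have "x b = 0" if ab: "(a, b) \<in> parcs G" "x a = 0" for a b
  proof -
    have "(\<Sum>u | (a, u) \<in> parcs G. x u) = 0"
      using assms(1) in_arcsD1[OF ab(1)] ab(2) by (simp add: sum_adjacency)
    then show ?thesis
      using ab(1) nonneg in_arcsD2 finite_neighbours by (subst (asm) sum_nonneg_eq_0_iff) auto
  qed
  then have "x w = 0" if "w \<in> pverts G" for w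
    using neighbour_induct[OF v that, of "\<lambda>w. x w = 0"] \<open>x v = 0\<close> by blast
  then show False using assms(3) by blast
qed

lemma positive_eigenfunction_exists:
  obtains x :: "'a \<Rightarrow> real" and l :: real
  where "eigenfunction l x" "\<forall>v\<in>pverts G. 0 < x v"
proof -
  have nonneg: "0 \<le> (adjacency G u v :: real)" for u v by (simp add: adjacency_def)
  obtain x :: "'a \<Rightarrow> real" and l where "\<forall>v\<in>pverts G. 0 \<le> x v" "\<exists>v\<in>pverts G. x v \<noteq> 0" "eigenfunction l x"
    using symmetric_nonneg_kernel_eigenfunction[of "pverts G" "adjacency G",
        OF pair_finite_verts pverts_nonempty adjacency_sym nonneg] by blast
  then show thesis using nonneg_eigenfunction_pos[of x l] by (intro that[of x l]) auto
qed

text \<open>At a vertex \<open>w\<close> maximising \<open>cmod (z v) / y v\<close>, the triangle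
  inequality bounds the equation for \<open>z\<close> by a multiple of the equation for
  \<open>y\<close>. The eigenvalue \<open>k\<close> is complex because
  \<open>spectral_radius\<close> ranges over the complex spectrum.\<close>

lemma eigenvalue_le_positive_eigenvalue:
  fixes z :: "'a \<Rightarrow> complex" and y :: "'a \<Rightarrow> real"
  assumes y: "eigenfunction l y" "\<forall>v\<in>pverts G. 0 < y v"
    and z: "eigenfunction k z" "\<exists>v\<in>pverts G. z v \<noteq> 0"
  shows "cmod k \<le> l"
proof -
  define r where "r v = cmod (z v) / y v" for v
  define m where "m = Max (r ` pverts G)"
  have le: "r v \<le> m" if "v \<in> pverts G" for v
    unfolding m_def using that pair_finite_verts by simp
  have "m \<in> r ` pverts G" unfolding m_def using pair_finite_verts pverts_nonempty by simp
  then obtain w where w: "w \<in> pverts G" "r w = m" by auto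
  have "0 < m"
  proof -
    obtain v where "v \<in> pverts G" "z v \<noteq> 0" using z(2) by blast
    then show ?thesis using le[of v] y(2) by (auto simp: r_def intro: less_le_trans[rotated])
  qed
  have zle: "cmod (z v) \<le> m * y v" if "v \<in> pverts G" for v
    using le[OF that] bspec[OF y(2) that] by (simp add: r_def field_simps)
  have zw: "cmod (z w) = m * y w" using w bspec[OF y(2) w(1)] by (auto simp: r_def field_simps)
  have "cmod k * (m * y w) = cmod (\<Sum>u | (w, u) \<in> parcs G. z u)"
    using z(1) w(1) by (simp add: sum_adjacency norm_mult zw)
  also have "\<dots> \<le> (\<Sum>u | (w, u) \<in> parcs G. m * y u)"
    using zle in_arcsD2 by (intro order.trans[OF norm_sum] sum_mono) auto
  also have "\<dots> = l * (m * y w)"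
    using y(1) w(1) by (simp add: sum_adjacency flip: sum_distrib_left)
  finally show ?thesis using \<open>0 < m\<close> bspec[OF y(2) w(1)] by simp
qed

text \<open>Read as a complex vector, \<open>y\<close> puts \<open>l\<close> into the spectrum, and
  by the previous bound no eigenvalue has modulus above \<open>l\<close>.\<close>

lemma graph_spectral_radius_eqI:
  fixes y :: "'a \<Rightarrow> real"
  assumes y: "eigenfunction l y" "\<forall>v\<in>pverts G. 0 < y v"
  shows "graph_spectral_radius G = l"
proof -
  obtain vs where vs: "distinct vs" "set vs = pverts G"
    using finite_distinct_list[OF pair_finite_verts] by blast
  define M :: "complex mat" where "M = adjacency_matrix G vs"
  have M: "M \<in> carrier_mat (length vs) (length vs)" by (simp add: M_def adjacency_matrix_def)
  have n: "0 < length vs" using vs(2) pverts_nonempty by auto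
  note ev = eigenvalue_adjacency_matrix[OF vs, where 'c = complex]
  obtain w where w: "w \<in> pverts G" using pverts_nonempty by blast
  have "0 \<le> l"
  proof -
    have "0 \<le> (\<Sum>u | (w, u) \<in> parcs G. y u)"
      using y(2) in_arcsD2 by (intro sum_nonneg) (auto intro: less_imp_le)
    then have "0 \<le> l * y w" using y(1) w by (simp add: sum_adjacency)
    then show ?thesis using bspec[OF y(2) w] by (simp add: zero_le_mult_iff)
  qed
  have "(\<Sum>u\<in>pverts G. adjacency G v u * complex_of_real (y u)) = of_real l * of_real (y v)"
    if "v \<in> pverts G" for v
    using y(1) that by (simp add: sum_adjacency flip: of_real_sum of_real_mult)
  then have "eigenvalue M (of_real l)"
    unfolding M_def ev using w y(2) by (intro exI[of _ "\<lambda>v. of_real (y v)"]) force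
  then have "cmod (of_real l) \<le> spectral_radius M"
    by (intro spectral_radius_mem_max(2)[OF M n]) (auto simp: spectrum_def simp del: norm_of_real)
  moreover have "spectral_radius M \<le> l"
  proof -
    obtain k where k: "eigenvalue M k" "spectral_radius M = cmod k"
      using spectral_radius_mem_max(1)[OF M n] by (auto simp: spectrum_def)
    then show ?thesis
      using eigenvalue_le_positive_eigenvalue[OF y] unfolding M_def ev by auto
  qed
  ultimately show ?thesis
    using \<open>0 \<le> l\<close> spectral_radius_adjacency_matrix[OF vs] by (simp add: M_def)
qed

text \<open>With \<open>t\<close> the smallest ratio \<open>x v / y v\<close>, the eigenfunction \<open>x - t y\<close> is nonnegative and
  vanishes somewhere, hence everywhere.\<close>

lemma eigenfunction_proportional:
  fixes x y :: "'a \<Rightarrow> real"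
  assumes y: "eigenfunction l y" "\<forall>v\<in>pverts G. 0 < y v"
    and x: "eigenfunction l x"
  obtains t where "\<And>v. v \<in> pverts G \<Longrightarrow> x v = t * y v"
proof -
  define t where "t = Min ((\<lambda>v. x v / y v) ` pverts G)"
  have "t \<in> (\<lambda>v. x v / y v) ` pverts G"
    unfolding t_def using pair_finite_verts pverts_nonempty by simp
  then obtain w where w: "w \<in> pverts G" "x w - t * y w = 0" using y(2) by fastforce
  have "0 \<le> x v - t * y v" if "v \<in> pverts G" for v
  proof -
    have "t \<le> x v / y v" unfolding t_def using that pair_finite_verts by simp
    then show ?thesis using bspec[OF y(2) that] by (simp add: field_simps)
  qed
  moreover have "eigenfunction l (\<lambda>v. x v - t * y v)"
    using x y(1) by (simp add: sum_adjacency sum_subtractf flip: sum_distrib_left)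
      (simp add: algebra_simps)
  ultimately have "x v - t * y v = 0" if "v \<in> pverts G" for v
    using nonneg_eigenfunction_pos[of "\<lambda>v. x v - t * y v" l w] w that by fastforce
  then show thesis by (intro that[of t]) simp
qed

text \<open>Resolves the definite description: normalising \<open>y\<close> gives existence; any
  other candidate is a multiple of \<open>y\<close>, and the sum condition fixes the factor.\<close>

lemma principal_eigenvector_eq:
  fixes y :: "'a \<Rightarrow> real"
  assumes y: "eigenfunction l y" "\<forall>v\<in>pverts G. 0 < y v"
  shows "principal_eigenvector G = (\<lambda>v\<in>pverts G. y v / (\<Sum>u\<in>pverts G. y u))"
  unfolding principal_eigenvector_def graph_spectral_radius_eqI[OF y]
proof (rule the_equality)
  let ?S = "\<Sum>u\<in>pverts G. y u"
  have S: "0 < ?S" using y(2) pair_finite_verts pverts_nonempty by (intro sum_pos) auto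
  let ?x = "\<lambda>v\<in>pverts G. y v / ?S"
  have "(\<Sum>u | (v, u) \<in> parcs G. ?x u) = (\<Sum>u | (v, u) \<in> parcs G. y u / ?S)" for v
    using in_arcsD2 by (intro sum.cong) auto
  then have "eigenfunction l ?x"
    using y(1) by (simp add: sum_adjacency flip: sum_divide_distrib)
  moreover have "(\<Sum>v\<in>pverts G. ?x v) = 1" using S by (simp flip: sum_divide_distrib)
  ultimately show "?x \<in> extensional (pverts G) \<and> eigenfunction l ?x \<and> (\<Sum>v\<in>pverts G. ?x v) = 1"
    by simp
  fix x assume x: "x \<in> extensional (pverts G) \<and> eigenfunction l x \<and> (\<Sum>v\<in>pverts G. x v) = 1"
  then obtain t where t: "\<And>v. v \<in> pverts G \<Longrightarrow> x v = t * y v"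
    using eigenfunction_proportional[OF y] by metis
  then have "t * ?S = 1" using x by (simp add: sum_distrib_left)
  then have "t = 1 / ?S" using S by (simp add: field_simps)
  then show "x = ?x" using x t by (intro extensionalityI[of x "pverts G"]) auto
qed

text \<open>The normalising factor cancels in the quotient, so any positive eigenfunction can
  replace the principal eigenvector.\<close>

lemma principal_ratio_eq:
  fixes y :: "'a \<Rightarrow> real"
  assumes y: "eigenfunction l y" "\<forall>v\<in>pverts G. 0 < y v"
  shows "principal_ratio G = Max (y ` pverts G) / Min (y ` pverts G)"
proof -
  define S where "S = (\<Sum>u\<in>pverts G. y u)"
  have S: "0 < S"
    unfolding S_def using y(2) pair_finite_verts pverts_nonempty by (intro sum_pos) auto
  have im: "principal_eigenvector G ` pverts G = (\<lambda>r. r / S) ` y ` pverts G"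
    unfolding principal_eigenvector_eq[OF y] S_def image_image by (rule image_cong) auto
  have "mono (\<lambda>r. r / S)" using S by (auto intro!: monoI divide_right_mono)
  from mono_Max_commute[OF this, of "y ` pverts G"] mono_Min_commute[OF this, of "y ` pverts G"]
  have "principal_ratio G = (Max (y ` pverts G) / S) / (Min (y ` pverts G) / S)"
    unfolding principal_ratio_def im using pair_finite_verts pverts_nonempty by simp
  then show ?thesis using S by simp
qed

end

section \<open>Equitable colourings and their divisor matrices\<close>

locale equitable_colouring = connected_pair_graph G for G :: "'a pair_pre_digraph" +
  fixes c :: "'a \<Rightarrow> 'i" and s :: "'i \<Rightarrow> 'i \<Rightarrow> nat"
  assumes equitable: "\<And>v j. v \<in> pverts G \<Longrightarrow> j \<in> c ` pverts G \<Longrightarrow>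
    card {w. (v, w) \<in> parcs G \<and> c w = j} = s (c v) j"
begin

definition colour_class :: "'i \<Rightarrow> 'a set" where
  "colour_class i = {v \<in> pverts G. c v = i}"

lemma finite_colours: "finite (c ` pverts G)"
  by (simp add: pair_finite_verts)

lemma finite_colour_class: "finite (colour_class i)"
  by (simp add: colour_class_def pair_finite_verts)

lemma card_colour_class_pos: "i \<in> c ` pverts G \<Longrightarrow> 0 < card (colour_class i)"
  by (auto simp: card_gt_0_iff finite_colour_class) (auto simp: colour_class_def)

lemma sum_by_colour:
  fixes f :: "'a \<Rightarrow> 'r::comm_ring_1"
  shows "(\<Sum>v\<in>pverts G. f v) = (\<Sum>i\<in>c ` pverts G. \<Sum>v\<in>colour_class i. f v)"
  unfolding colour_class_def by (rule sum.image_gen[OF pair_finite_verts])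

lemma sum_colour:
  fixes f :: "'i \<Rightarrow> 'r::comm_ring_1"
  shows "(\<Sum>v\<in>pverts G. f (c v)) = (\<Sum>i\<in>c ` pverts G. of_nat (card (colour_class i)) * f i)"
  unfolding sum_by_colour by (rule sum.cong) (auto simp: colour_class_def)

lemma sum_neighbours_colour:
  fixes f :: "'i \<Rightarrow> 'r::comm_ring_1"
  assumes "v \<in> pverts G"
  shows "(\<Sum>u | (v, u) \<in> parcs G. f (c u)) = (\<Sum>j\<in>c ` pverts G. of_nat (s (c v) j) * f j)"
proof -
  have "(\<Sum>u | (v, u) \<in> parcs G. f (c u)) =
      (\<Sum>j\<in>c ` pverts G. \<Sum>u | u \<in> {u. (v, u) \<in> parcs G} \<and> c u = j. f (c u))"
    using finite_neighbours finite_colours in_arcsD2 by (intro sum.group[symmetric]) auto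
  also have "\<dots> = (\<Sum>j\<in>c ` pverts G. of_nat (s (c v) j) * f j)"
  proof (rule sum.cong)
    fix j assume "j \<in> c ` pverts G"
    from equitable[OF assms this]
    show "(\<Sum>u | u \<in> {u. (v, u) \<in> parcs G} \<and> c u = j. f (c u)) = of_nat (s (c v) j) * f j"
      by simp
  qed simp
  finally show ?thesis .
qed

lemma out_degree_colour:
  assumes "v \<in> pverts G"
  shows "out_degree (with_proj G) v = (\<Sum>j\<in>c ` pverts G. s (c v) j)"
proof -
  \<comment> \<open>\<open>sum_neighbours_colour\<close> is stated over rings, so neighbours are
    counted in the integers.\<close>
  have "int (out_degree (with_proj G) v) = int (\<Sum>j\<in>c ` pverts G. s (c v) j)"
    using sum_neighbours_colour[OF assms, of "\<lambda>_. 1 :: int"] by (simp add: out_degree_eq_card)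
  then show ?thesis by (simp only: of_nat_eq_iff)
qed

lemma card_arcs_between:
  assumes "i \<in> c ` pverts G" "j \<in> c ` pverts G"
  shows "card {(v, w) \<in> parcs G. c v = i \<and> c w = j} = card (colour_class i) * s i j"
proof -
  have "{(v, w) \<in> parcs G. c v = i \<and> c w = j}
      = (SIGMA v:colour_class i. {w. (v, w) \<in> parcs G \<and> c w = j})"
    using in_arcsD1 by (auto simp: colour_class_def)
  moreover have "card (SIGMA v:colour_class i. {w. (v, w) \<in> parcs G \<and> c w = j})
      = (\<Sum>v\<in>colour_class i. card {w. (v, w) \<in> parcs G \<and> c w = j})"
    by (rule card_SigmaI[OF finite_colour_class])
      (auto intro: finite_subset[OF _ finite_neighbours])
  moreover have "\<dots> = (\<Sum>v\<in>colour_class i. s i j)"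
    using assms(2) by (intro sum.cong) (auto simp: colour_class_def equitable)
  ultimately show ?thesis by simp
qed

text \<open>Reversing arcs matches those from class \<open>i\<close> to class \<open>j\<close> with
  those from \<open>j\<close> to \<open>i\<close>.\<close>

lemma class_balance:
  assumes "i \<in> c ` pverts G" "j \<in> c ` pverts G"
  shows "card (colour_class i) * s i j = card (colour_class j) * s j i"
proof -
  have "bij_betw prod.swap {(v, w) \<in> parcs G. c v = i \<and> c w = j}
      {(v, w) \<in> parcs G. c v = j \<and> c w = i}"
    using arc_sym by (intro bij_betwI[where g = prod.swap]) auto
  from bij_betw_same_card[OF this] show ?thesis
    using card_arcs_between assms by simp
qed

text \<open>Allows entries between adjacent colours to be cancelled in
  \<open>class_sizes_proportional\<close>.\<close>

lemma divisor_entry_pos: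
  assumes "(v, w) \<in> parcs G"
  shows "0 < s (c v) (c w)"
proof -
  have "finite {u. (v, u) \<in> parcs G \<and> c u = c w}"
    by (rule finite_subset[OF _ finite_neighbours]) auto
  then have "0 < card {u. (v, u) \<in> parcs G \<and> c u = c w}"
    using assms by (auto simp: card_gt_0_iff)
  then show ?thesis using equitable[of v "c w"] assms in_arcsD1 in_arcsD2 by auto
qed

text \<open>Summing the eigenvalue equation over a class shows that the class sums \<open>Y\<close>
  form a left eigenvector of \<open>s\<close>. By \<open>class_balance\<close>, dividing by the
  class sizes turns it into the right eigenvector \<open>z\<close>.\<close>

lemma positive_divisor_eigenvector_exists:
  obtains z :: "'i \<Rightarrow> real" and l :: real
  where "\<And>i. i \<in> c ` pverts G \<Longrightarrow> (\<Sum>j\<in>c ` pverts G. s i j * z j) = l * z i"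
    "\<And>i. i \<in> c ` pverts G \<Longrightarrow> 0 < z i"
proof -
  obtain y :: "'a \<Rightarrow> real" and l where y: "eigenfunction l y" "\<forall>v\<in>pverts G. 0 < y v"
    using positive_eigenfunction_exists by blast
  define n where "n i = real (card (colour_class i))" for i
  define Y where "Y i = (\<Sum>v\<in>colour_class i. y v)" for i
  define z where "z i = Y i / n i" for i
  have n: "0 < n i" if "i \<in> c ` pverts G" for i
    using card_colour_class_pos[OF that] by (simp add: n_def)
  have Y: "Y i = n i * z i" if "i \<in> c ` pverts G" for i using n[OF that] by (simp add: z_def)
  have "(\<Sum>j\<in>c ` pverts G. s i j * z j) = l * z i" if i: "i \<in> c ` pverts G" for i
  proof -
    have "l * Y i = (\<Sum>v\<in>colour_class i. \<Sum>u\<in>pverts G. adjacency G v u * y u)"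
      using y(1) by (simp add: Y_def sum_distrib_left colour_class_def)
    also have "\<dots> = (\<Sum>u\<in>pverts G. y u * (\<Sum>v\<in>colour_class i. adjacency G u v))"
      by (subst sum.swap) (simp add: sum_distrib_left mult.commute adjacency_sym)
    \<comment> \<open>The inner sum counts the neighbours of \<open>u\<close> of colour
      \<open>i\<close>; hence the transposed entry.\<close>
    also have "\<dots> = (\<Sum>u\<in>pverts G. y u * s (c u) i)"
    proof (rule sum.cong)
      fix u assume u: "u \<in> pverts G"
      have "(\<Sum>v\<in>colour_class i. adjacency G u v :: real) =
          (\<Sum>v\<in>pverts G. adjacency G u v * of_bool (c v = i))"
        unfolding colour_class_def sum.inter_filter[OF pair_finite_verts]
        by (rule sum.cong) auto
      also have "\<dots> = s (c u) i"
        unfolding sum_adjacency sum_neighbours_colour[OF u, of "\<lambda>j. of_bool (j = i)"]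
        using i by (simp add: of_bool_def if_distrib finite_colours cong: if_cong)
      finally show "y u * (\<Sum>v\<in>colour_class i. adjacency G u v) = y u * s (c u) i" by simp
    qed simp
    also have "\<dots> = (\<Sum>j\<in>c ` pverts G. Y j * s j i)"
      unfolding sum_by_colour Y_def sum_distrib_right
      by (intro sum.cong) (auto simp: colour_class_def)
    also have "\<dots> = (\<Sum>j\<in>c ` pverts G. n i * (s i j * z j))"
    proof (rule sum.cong)
      fix j assume j: "j \<in> c ` pverts G"
      have "n j * s j i = n i * s i j"
        using class_balance[OF i j] by (simp add: n_def flip: of_nat_mult)
      then show "Y j * s j i = n i * (s i j * z j)" using Y[OF j] by (simp add: algebra_simps)
    qed simp
    finally have "n i * (l * z i) = n i * (\<Sum>j\<in>c ` pverts G. s i j * z j)"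
      using Y[OF i] by (simp add: sum_distrib_left algebra_simps)
    then show ?thesis using n[OF i] by simp
  qed
  moreover have "0 < z i" if i: "i \<in> c ` pverts G" for i
  proof -
    have "colour_class i \<noteq> {}" using i by (auto simp: colour_class_def)
    then have "0 < Y i"
      unfolding Y_def using finite_colour_class y(2) by (intro sum_pos) (auto simp: colour_class_def)
    then show ?thesis using n[OF i] by (simp add: z_def)
  qed
  ultimately show thesis by (rule that)
qed

text \<open>The lift \<open>z \<circ> c\<close> is a positive eigenfunction, since its equation at
  \<open>v\<close> is row \<open>c v\<close> of the equation for \<open>z\<close>. The resulting
  ratio depends only on \<open>z\<close> and the set of colours.\<close>

lemma principal_ratio_colour:
  fixes z :: "'i \<Rightarrow> real"
  assumes "\<And>i. i \<in> c ` pverts G \<Longrightarrow> (\<Sum>j\<in>c ` pverts G. s i j * z j) = l * z i"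
    and "\<And>i. i \<in> c ` pverts G \<Longrightarrow> 0 < z i"
  shows "principal_ratio G = Max (z ` c ` pverts G) / Min (z ` c ` pverts G)"
proof -
  have "eigenfunction l (z \<circ> c)"
    using assms(1) sum_neighbours_colour[of _ z] by (simp add: sum_adjacency)
  then show ?thesis using principal_ratio_eq[of "z \<circ> c" l] assms(2) by (simp add: image_comp)
qed

end

section \<open>Two graphs with a common divisor matrix\<close>

locale common_equitable_colouring =
  G: equitable_colouring G c s + H: equitable_colouring H d s
  for G :: "'a pair_pre_digraph" and H :: "'b pair_pre_digraph"
    and c :: "'a \<Rightarrow> 'i" and d :: "'b \<Rightarrow> 'i" and s :: "'i \<Rightarrow> 'i \<Rightarrow> nat" +
  assumes same_colours: "c ` pverts G = d ` pverts H"
begin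

text \<open>By \<open>class_balance\<close>, both ratios of class sizes of adjacent colours \<open>i\<close>, \<open>j\<close> are
  \<open>s j i / s i j\<close>; connectedness extends the proportionality to all colours.\<close>

lemma class_sizes_proportional:
  obtains r :: real where "r > 0"
    "\<And>i. i \<in> c ` pverts G \<Longrightarrow> real (card (H.colour_class i)) = r * real (card (G.colour_class i))"
proof -
  obtain u where u: "u \<in> pverts G" using G.pverts_nonempty by blast
  let ?n = "\<lambda>i. real (card (G.colour_class i))" and ?m = "\<lambda>i. real (card (H.colour_class i))"
  have n: "0 < ?n i" if "i \<in> c ` pverts G" for i using G.card_colour_class_pos that by simp
  have m: "0 < ?m i" if "i \<in> c ` pverts G" for i
    using H.card_colour_class_pos that same_colours by simp
  define r where "r = ?m (c u) / ?n (c u)"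
  have step: "?m (c b) = r * ?n (c b)" if ab: "(a, b) \<in> parcs G" "?m (c a) = r * ?n (c a)" for a b
  proof -
    have i: "c a \<in> c ` pverts G" "c b \<in> c ` pverts G"
      using ab(1) G.in_arcsD1 G.in_arcsD2 by blast+
    have eqs: "?n (c a) * s (c a) (c b) = ?n (c b) * s (c b) (c a)"
      "?m (c a) * s (c a) (c b) = ?m (c b) * s (c b) (c a)"
      using G.class_balance[OF i] H.class_balance[of "c a" "c b"] i same_colours
      by (simp_all flip: of_nat_mult)
    have "?m (c b) * s (c b) (c a) = r * ?n (c b) * s (c b) (c a)"
      using eqs ab(2) by (metis mult.assoc)
    moreover have "0 < s (c b) (c a)" using G.divisor_entry_pos ab(1) G.arc_sym by blast
    ultimately show ?thesis by auto
  qed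
  have "?m (c v) = r * ?n (c v)" if v: "v \<in> pverts G" for v
    by (rule G.neighbour_induct[OF u v]) (use step n u in \<open>auto simp: r_def\<close>)
  moreover have "r > 0" using n m u by (simp add: r_def)
  ultimately show thesis using that[of r] by blast
qed

text \<open>Passing from \<open>G\<close> to \<open>H\<close> multiplies both the sum and, by the
  case of the constant 1, the number of vertices by the same \<open>r\<close>.\<close>

lemma average_eq:
  fixes f :: "'i \<Rightarrow> real"
  shows "(\<Sum>v\<in>pverts G. f (c v)) / real (card (pverts G)) =
    (\<Sum>v\<in>pverts H. f (d v)) / real (card (pverts H))"
proof -
  obtain r where r: "r > 0" "\<And>i. i \<in> c ` pverts G \<Longrightarrow>
      real (card (H.colour_class i)) = r * real (card (G.colour_class i))"
    using class_sizes_proportional by blast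
  have "(\<Sum>v\<in>pverts H. g (d v)) = r * (\<Sum>v\<in>pverts G. g (c v))" for g :: "'i \<Rightarrow> real"
    unfolding H.sum_colour G.sum_colour sum_distrib_left same_colours[symmetric]
    using r(2) by (intro sum.cong) auto
  from this[of f] this[of "\<lambda>_. 1"] show ?thesis using r(1) by simp
qed

lemma degree_image_eq:
  "out_degree (with_proj G) ` pverts G = out_degree (with_proj H) ` pverts H"
proof -
  let ?D = "\<lambda>i. \<Sum>j\<in>c ` pverts G. s i j"
  have "out_degree (with_proj G) ` pverts G = ?D ` c ` pverts G"
    unfolding image_image using G.out_degree_colour by (intro image_cong) auto
  moreover have "out_degree (with_proj H) ` pverts H = ?D ` d ` pverts H"
    unfolding image_image same_colours using H.out_degree_colour by (intro image_cong) auto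
  ultimately show ?thesis using same_colours by simp
qed

lemma degree_average_eq:
  fixes f :: "real \<Rightarrow> real"
  shows "(\<Sum>v\<in>pverts G. f (out_degree (with_proj G) v)) / real (card (pverts G)) =
    (\<Sum>v\<in>pverts H. f (out_degree (with_proj H) v)) / real (card (pverts H))"
  using average_eq[of "\<lambda>i. f (\<Sum>j\<in>c ` pverts G. s i j)"]
  by (simp add: G.out_degree_colour H.out_degree_colour same_colours)

lemma invariants_eq:
  "min_degree G = min_degree H" "max_degree G = max_degree H"
  "average_degree G = average_degree H" "degree_variance G = degree_variance H"
  "principal_ratio G = principal_ratio H"
proof -
  show "min_degree G = min_degree H" "max_degree G = max_degree H"
    unfolding min_degree_def max_degree_def degree_image_eq by simp_all
  show avg: "average_degree G = average_degree H"
    unfolding average_degree_def by (rule degree_average_eq[of "\<lambda>x. x"])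
  \<comment> \<open>By \<open>avg\<close> the deviations in both graphs are taken from the same
    number, so the summand is one fixed function of the degree.\<close>
  show "degree_variance G = degree_variance H"
    unfolding degree_variance_def avg
    by (rule degree_average_eq[of "\<lambda>x. (x - average_degree H)\<^sup>2"])
  obtain z :: "'i \<Rightarrow> real" and l
    where "\<And>i. i \<in> c ` pverts G \<Longrightarrow> (\<Sum>j\<in>c ` pverts G. s i j * z j) = l * z i"
      "\<And>i. i \<in> c ` pverts G \<Longrightarrow> 0 < z i"
    using G.positive_divisor_eigenvector_exists by blast
  then show "principal_ratio G = principal_ratio H"
    using G.principal_ratio_colour[of z l] H.principal_ratio_colour[of z l]
    by (simp add: same_colours)
qed

end

section \<open>Colourings from orbits and from isomorphisms\<close>

text \<open>A vertex is coloured by the position of its orbit in the chosen ordering. Positions,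
  unlike orbits, are shared by graphs on different vertex types, and they index the equal
  matrices.\<close>

lemma orbits_common_equitable_colouring:
  assumes G: "connected_pair_graph G" and H: "connected_pair_graph H"
    and "orbitally_similar G H"
  obtains c d and s :: "nat \<Rightarrow> nat \<Rightarrow> nat" where "common_equitable_colouring G H c d s"
proof -
  obtain Os Ps where Os: "orbit_ordering G Os" and Ps: "orbit_ordering H Ps"
    and len: "length Os = length Ps"
    and mat: "orbit_divisor_matrix G Os = orbit_divisor_matrix H Ps"
    using assms(3) unfolding orbitally_similar_def by blast
  have colouring: "\<exists>c. equitable_colouring K c (\<lambda>i j. orbit_divisor_matrix K Qs $$ (i, j)) \<and>
      c ` pverts K = {..<length Qs}"
    if K: "connected_pair_graph K" and Qs: "orbit_ordering K Qs" for K :: "'c pair_pre_digraph" and Qs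
  proof -
    interpret connected_pair_graph K by fact
    have pg: "pair_graph K" by unfold_locales
    note eqv = equiv_automorphically_similar[OF pg]
    have orb: "Qs ! i \<in> orbits K" if "i < length Qs" for i
      using Qs nth_mem[OF that] by (simp add: orbit_ordering_def)
    have ex: "\<exists>i<length Qs. v \<in> Qs ! i" if "v \<in> pverts K" for v
    proof -
      have "v \<in> \<Union> (orbits K)"
        unfolding orbits_def using Union_quotient[OF eqv] that by simp
      then show ?thesis using Qs by (metis UnionE in_set_conv_nth orbit_ordering_def)
    qed
    have uniq: "i = j" if "i < length Qs" "j < length Qs" "v \<in> Qs ! i" "v \<in> Qs ! j" for i j v
    proof -
      have "Qs ! i = Qs ! j"
        using quotient_disj[OF eqv] orb that unfolding orbits_def by blast
      then show ?thesis using Qs that by (simp add: orbit_ordering_def nth_eq_iff_index_eq)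
    qed
    define c where "c v = (THE i. i < length Qs \<and> v \<in> Qs ! i)" for v
    have c: "c v = i" if "i < length Qs" "v \<in> Qs ! i" for v i
      unfolding c_def using uniq that by blast
    have cv: "c v < length Qs" "v \<in> Qs ! c v" if "v \<in> pverts K" for v
      using ex[OF that] c by auto
    have sub: "Qs ! i \<subseteq> pverts K" if "i < length Qs" for i
      using orb[OF that] in_quotient_imp_subset[OF eqv] unfolding orbits_def by blast
    have nonempty: "Qs ! i \<noteq> {}" if "i < length Qs" for i
      using orb[OF that] in_quotient_imp_non_empty[OF eqv] unfolding orbits_def by blast
    have im: "c ` pverts K = {..<length Qs}"
    proof
      show "{..<length Qs} \<subseteq> c ` pverts K"
      proof
        fix i assume "i \<in> {..<length Qs}"
        then have i: "i < length Qs" by simp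
        then obtain v where "v \<in> Qs ! i" using nonempty by blast
        then show "i \<in> c ` pverts K" using c[OF i] sub[OF i] by force
      qed
      show "c ` pverts K \<subseteq> {..<length Qs}" using cv(1) by auto
    qed
    have "equitable_colouring K c (\<lambda>i j. orbit_divisor_matrix K Qs $$ (i, j))"
    proof unfold_locales
      fix v j assume v: "v \<in> pverts K" and "j \<in> c ` pverts K"
      then have j: "j < length Qs" by (simp add: im)
      have "{w. (v, w) \<in> parcs K \<and> c w = j} = {w \<in> Qs ! j. (v, w) \<in> parcs K}"
      proof (intro Collect_cong iffI conjI; elim conjE)
        fix w assume "(v, w) \<in> parcs K" "c w = j"
        then show "w \<in> Qs ! j" using cv(2) in_arcsD2 by blast
      qed (use c[OF j] in auto)
      \<comment> \<open>\<open>orbit_degree_eqI\<close> lets \<open>v\<close> itself replace the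
        representative chosen in \<open>orbit_degree\<close>.\<close>
      then show "card {w. (v, w) \<in> parcs K \<and> c w = j} = orbit_divisor_matrix K Qs $$ (c v, j)"
        using orbit_degree_eqI[OF pg orb orb[OF j] cv(2)] cv v j
        by (simp add: orbit_divisor_matrix_def)
    qed
    then show ?thesis using im by blast
  qed
  obtain c where c: "equitable_colouring G c (\<lambda>i j. orbit_divisor_matrix G Os $$ (i, j))"
      "c ` pverts G = {..<length Os}"
    using colouring[OF G Os] by blast
  obtain d where d: "equitable_colouring H d (\<lambda>i j. orbit_divisor_matrix H Ps $$ (i, j))"
      "d ` pverts H = {..<length Ps}"
    using colouring[OF H Ps] by blast
  show thesis
    by (rule that) (use c d len mat in
      \<open>auto simp: common_equitable_colouring_def common_equitable_colouring_axioms_def\<close>)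
qed

text \<open>Isomorphic graphs are coloured by the vertices of one of them.\<close>

lemma iso_common_equitable_colouring:
  assumes G: "connected_pair_graph G" and H: "connected_pair_graph H"
    and "digraph_iso (with_proj H) (with_proj G)"
  obtains d s where "common_equitable_colouring G H (\<lambda>v. v) d s"
proof -
  interpret G: connected_pair_graph G by fact
  interpret H: connected_pair_graph H by fact
  obtain f where f: "H.digraph_isomorphism f" "with_proj G = app_iso f (with_proj H)"
    using assms(3) unfolding digraph_iso_def by auto
  let ?d = "iso_verts f"
  have V: "?d ` pverts H = pverts G" and A: "iso_arcs f ` parcs H = parcs G"
    and t: "iso_tail f = fst" and h: "iso_head f = snd"
    using f(2) by (simp_all add: app_iso_def with_proj_def)
  have inj: "inj_on ?d (pverts H)"
    and th: "\<And>a. a \<in> parcs H \<Longrightarrow> iso_arcs f a = (?d (fst a), ?d (snd a))"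
    using f(1) by (auto simp: H.digraph_isomorphism_def t h prod_eq_iff)
  have adj: "(?d a, ?d b) \<in> parcs G \<longleftrightarrow> (a, b) \<in> parcs H"
    if ab: "a \<in> pverts H" "b \<in> pverts H" for a b
  proof
    assume "(a, b) \<in> parcs H"
    then show "(?d a, ?d b) \<in> parcs G" using A th by force
  next
    assume "(?d a, ?d b) \<in> parcs G"
    \<comment> \<open>The arc map is a separate component of \<open>f\<close>, so the preimage
      \<open>e\<close> is identified with \<open>(a, b)\<close> only through its end vertices and
      injectivity of \<open>?d\<close>.\<close>
    then obtain e where e: "e \<in> parcs H" "iso_arcs f e = (?d a, ?d b)" using A by force
    then have "?d (fst e) = ?d a" "?d (snd e) = ?d b" using th by auto
    then have "fst e = a" "snd e = b"
      using inj ab e(1) H.arc_fst_in_verts H.arc_snd_in_verts by (auto dest: inj_onD)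
    then show "(a, b) \<in> parcs H" using e(1) by (cases e) auto
  qed
  \<comment> \<open>With every vertex its own colour, the divisor matrix is the adjacency
    matrix.\<close>
  have "equitable_colouring G (\<lambda>v. v) (\<lambda>u v. adjacency G u v)"
  proof unfold_locales
    fix v j
    have "{w. (v, w) \<in> parcs G \<and> w = j} = (if (v, j) \<in> parcs G then {j} else {})" by auto
    then show "card {w. (v, w) \<in> parcs G \<and> w = j} = adjacency G v j"
      by (simp add: adjacency_def)
  qed
  moreover have "equitable_colouring H ?d (\<lambda>u v. adjacency G u v)"
  proof unfold_locales
    fix v j assume v: "v \<in> pverts H" and "j \<in> ?d ` pverts H"
    then obtain w where w: "w \<in> pverts H" "j = ?d w" by blast
    have "{u. (v, u) \<in> parcs H \<and> ?d u = j} = (if (v, w) \<in> parcs H then {w} else {})"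
      using w inj H.in_arcsD2 by (auto dest: inj_onD)
    then show "card {u. (v, u) \<in> parcs H \<and> ?d u = j} = adjacency G (?d v) j"
      using adj[OF v w(1)] w(2) by (simp add: adjacency_def)
  qed
  ultimately show thesis
    using V by (intro that[of ?d "adjacency G"])
      (simp add: common_equitable_colouring_def common_equitable_colouring_axioms_def)
qed

theorem theorem4:
  fixes G :: "'a pair_pre_digraph" and Gs :: "nat \<Rightarrow> 'b pair_pre_digraph"
  assumes "pair_graph G" and "Digraph_Component.connected (with_proj G)"
    and "self_similar_sequence G Gs"
  shows "\<forall>k\<ge>1.
      min_degree (Gs k) = min_degree G \<and>
      max_degree (Gs k) = max_degree G \<and>
      average_degree (Gs k) = average_degree G \<and>
      degree_variance (Gs k) = degree_variance G \<and>
      principal_ratio (Gs k) = principal_ratio G"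
proof (intro allI impI)
  fix k :: nat assume k: "k \<ge> 1"
  have G: "connected_pair_graph G"
    using assms(1,2) by (simp add: connected_pair_graph_def connected_pair_graph_axioms_def)
  have Gs: "connected_pair_graph (Gs j)" if "j \<ge> 1" for j
    using assms(3) that unfolding self_similar_sequence_def
    by (simp add: connected_pair_graph_def connected_pair_graph_axioms_def)
  have sim: "orbitally_similar (Gs 1) (Gs k)" and iso: "digraph_iso (with_proj (Gs 1)) (with_proj G)"
    using assms(3) k by (auto simp: self_similar_sequence_def)
  \<comment> \<open>\<open>Gs 1\<close> is the link: isomorphic to \<open>G\<close> and orbitally
    similar to \<open>Gs k\<close>.\<close>
  obtain d s where "common_equitable_colouring G (Gs 1) (\<lambda>v. v) d s"
    using iso_common_equitable_colouring[OF G Gs iso] by auto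
  note 1 = common_equitable_colouring.invariants_eq[OF this]
  obtain c d' and s' :: "nat \<Rightarrow> nat \<Rightarrow> nat" where "common_equitable_colouring (Gs 1) (Gs k) c d' s'"
    using orbits_common_equitable_colouring[OF Gs Gs sim] k by auto
  note 2 = common_equitable_colouring.invariants_eq[OF this]
  show "min_degree (Gs k) = min_degree G \<and> max_degree (Gs k) = max_degree G \<and>
      average_degree (Gs k) = average_degree G \<and> degree_variance (Gs k) = degree_variance G \<and>
      principal_ratio (Gs k) = principal_ratio G"
    using 1 2 by simp
qed

end
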